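(* Let $X$ be a locally bounded coarsely SIN topological group. Then the lower and upper topologies agree on the group $\mathrm{Aut}(X)$ of bicontinuous group automorphisms of $X$.
   Context: A subset $B$ of a topological group $X$ is bounded if for every increasing sequence $V_1 \subseteq V_2 \subseteq \dots$ of open subsets of $X$ with $\bigcup_n V_n = X$ and $V_n^2 \subseteq V_{n+1}$ for all $n$, there is an index $k$ with $B \subseteq V_k$. The group $X$ is locally bounded if it admits a bounded identity neighborhood. The group $X$ is coarsely SIN if for any identity neighborhood $U$ and any bounded set $B$, there is an identity neighborhood $V$ such that $xVx^{-1} \subseteq U$ for all $x \in B$. The upper uniform structure of $X$ is generated by the entourages $\{(x,y) \mid x^{-1}y \in V,\ xy^{-1} \in V\}$ and the lower (Roelcke) uniform structure by the entourages $\{(x,y) \mid x \in VyV\}$, where $V$ runs among identity neighborhoods. For $X$ locally bounded, the upper (resp. lower) topology on $\mathrm{Aut}(X)$ is the topology of uniform biconvergence on bounded sets with respect to the upper (resp. lower) uniform structure of $X$: a net $(g_i)$ converges to $g$ if and only if both $g_i \to g$ and $g_i^{-1} \to g^{-1}$ uniformly on each bounded subset of $X$, with respect to that uniform structure. *)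

theory Defs
  imports "HOL-Analysis.Analysis" "HOL-Library.Set_Algebras"
begin

text \<open>
  A topological group is a type of class \<^class>\<open>topological_group_add\<close>. This class is
  not commutative and includes no separation axiom; it merely writes the group operation
  additively: \<open>x + y\<close>, \<open>- x\<close>, \<open>0\<close>, \<open>x + v - x\<close> stand for \<open>xy\<close>, the inverse of \<open>x\<close>, \<open>1\<close>
  and the conjugate of \<open>v\<close> by \<open>x\<close>. An identity neighborhood is a set \<open>V\<close> with
  \<open>0 \<in> interior V\<close>, not necessarily open. Sums of sets are those of \<open>Set_Algebras\<close>.
\<close>

definition group_bounded :: "'a::topological_group_add set \<Rightarrow> bool" where
  "group_bounded B \<longleftrightarrow>
     (\<forall>V :: nat \<Rightarrow> 'a set.
        (\<forall>n. open (V n)) \<and> (\<forall>n. V n \<subseteq> V (Suc n)) \<and> (\<Union>n. V n) = UNIV \<and>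
        (\<forall>n. V n + V n \<subseteq> V (Suc n)) \<longrightarrow> (\<exists>k. B \<subseteq> V k))"

definition locally_bounded :: "'a::topological_group_add itself \<Rightarrow> bool" where
  "locally_bounded _ \<longleftrightarrow> (\<exists>U :: 'a set. 0 \<in> interior U \<and> group_bounded U)"

definition coarsely_SIN :: "'a::topological_group_add itself \<Rightarrow> bool" where
  "coarsely_SIN _ \<longleftrightarrow>
     (\<forall>(U :: 'a set) B. 0 \<in> interior U \<and> group_bounded B \<longrightarrow>
        (\<exists>V. 0 \<in> interior V \<and> (\<forall>x\<in>B. (\<lambda>v. x + v - x) ` V \<subseteq> U)))"

text \<open>Uniform structures are represented, as in class \<^class>\<open>uniform_space\<close>, by filters
  on pairs, a relation \<open>E\<close> being an entourage iff \<open>eventually E \<U>\<close>.\<close>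

definition upper_uniformity :: "('a::topological_group_add \<times> 'a) filter" where
  "upper_uniformity =
     (INF V\<in>{V. 0 \<in> interior V}. principal {(x, y). - x + y \<in> V \<and> x + - y \<in> V})"

definition lower_uniformity :: "('a::topological_group_add \<times> 'a) filter" where
  "lower_uniformity =
     (INF V\<in>{V. 0 \<in> interior V}. principal {(x, y). x \<in> V + {y} + V})"

definition Aut :: "('a::topological_group_add \<Rightarrow> 'a) set" where
  "Aut = {g. bij g \<and> (\<forall>x y. g (x + y) = g x + g y) \<and>
             continuous_on UNIV g \<and> continuous_on UNIV (inv g)}"

definition biconv_nbhd ::
    "('a \<times> 'a \<Rightarrow> bool) \<Rightarrow> 'a set \<Rightarrow> ('a::topological_group_add \<Rightarrow> 'a) \<Rightarrow> ('a \<Rightarrow> 'a) set" where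
  "biconv_nbhd E B g = {h \<in> Aut. \<forall>x\<in>B. E (h x, g x) \<and> E (inv h x, inv g x)}"

text \<open>The topology of uniform biconvergence on bounded sets; the lemmas
  \<open>limitin_upper_topology\<close> and \<open>limitin_lower_topology\<close> below confirm that its convergent
  nets are the intended ones.\<close>

definition biconv_topology ::
    "('a::topological_group_add \<times> 'a) filter \<Rightarrow> ('a \<Rightarrow> 'a) topology" where
  "biconv_topology \<U> = topology (\<lambda>W. W \<subseteq> Aut \<and>
     (\<forall>g\<in>W. \<exists>E B. eventually E \<U> \<and> group_bounded B \<and> biconv_nbhd E B g \<subseteq> W))"

definition upper_topology :: "('a::topological_group_add \<Rightarrow> 'a) topology" where
  "upper_topology = biconv_topology upper_uniformity"

definition lower_topology :: "('a::topological_group_add \<Rightarrow> 'a) topology" where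
  "lower_topology = biconv_topology lower_uniformity"

definition uniformly_converges_on_bounded ::
    "('a::topological_group_add \<times> 'a) filter \<Rightarrow> ('i \<Rightarrow> 'a \<Rightarrow> 'a) \<Rightarrow> ('a \<Rightarrow> 'a) \<Rightarrow> 'i filter \<Rightarrow> bool"
  where
  "uniformly_converges_on_bounded \<U> f g F \<longleftrightarrow>
     (\<forall>B E. group_bounded B \<and> eventually E \<U> \<longrightarrow> (\<forall>\<^sub>F i in F. \<forall>x\<in>B. E (f i x, g x)))"

lemma group_bounded_empty: "group_bounded {}"
  by (simp add: group_bounded_def)

lemma group_bounded_Un:
  assumes "group_bounded A" "group_bounded B"
  shows "group_bounded (A \<union> B)"
  unfolding group_bounded_def
proof (intro allI impI)
  fix V :: "nat \<Rightarrow> 'a set"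
  assume V: "(\<forall>n. open (V n)) \<and> (\<forall>n. V n \<subseteq> V (Suc n)) \<and> (\<Union>n. V n) = UNIV \<and>
        (\<forall>n. V n + V n \<subseteq> V (Suc n))"
  obtain k l where kl: "A \<subseteq> V k" "B \<subseteq> V l"
    using assms V unfolding group_bounded_def by meson
  have mono: "m \<le> n \<Longrightarrow> V m \<subseteq> V n" for m n
    using V lift_Suc_mono_le[of V m n] by blast
  have "A \<union> B \<subseteq> V (max k l)"
    using kl mono[of k "max k l"] mono[of l "max k l"] by auto
  then show "\<exists>k. A \<union> B \<subseteq> V k" ..
qed

lemma openin_biconv_topology:
  "openin (biconv_topology \<U>) W \<longleftrightarrow> W \<subseteq> Aut \<and>
     (\<forall>g\<in>W. \<exists>E B. eventually E \<U> \<and> group_bounded B \<and> biconv_nbhd E B g \<subseteq> W)"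
proof -
  let ?P = "\<lambda>W. W \<subseteq> Aut \<and>
     (\<forall>g\<in>W. \<exists>E B. eventually E \<U> \<and> group_bounded B \<and> biconv_nbhd E B g \<subseteq> W)"
  have "istopology ?P"
    unfolding istopology_def
  proof (intro conjI allI impI)
    fix S T assume S: "?P S" and T: "?P T"
    show "S \<inter> T \<subseteq> Aut" using S by auto
    show "\<forall>g\<in>S \<inter> T. \<exists>E B. eventually E \<U> \<and> group_bounded B \<and> biconv_nbhd E B g \<subseteq> S \<inter> T"
    proof
      fix g assume "g \<in> S \<inter> T"
      then obtain E B E' B' where
        *: "eventually E \<U>" "group_bounded B" "biconv_nbhd E B g \<subseteq> S"
           "eventually E' \<U>" "group_bounded B'" "biconv_nbhd E' B' g \<subseteq> T"
        using S T by (metis IntD1 IntD2)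
      have "eventually (\<lambda>p. E p \<and> E' p) \<U>"
        using * by (simp add: eventually_conj)
      moreover have "biconv_nbhd (\<lambda>p. E p \<and> E' p) (B \<union> B') g \<subseteq> S \<inter> T"
        using *(3,6) unfolding biconv_nbhd_def by blast
      ultimately show "\<exists>E B. eventually E \<U> \<and> group_bounded B \<and> biconv_nbhd E B g \<subseteq> S \<inter> T"
        using group_bounded_Un *(2,5) by blast
    qed
  next
    fix \<K> assume "\<forall>K\<in>\<K>. ?P K"
    then show "\<Union>\<K> \<subseteq> Aut"
      and "\<forall>g\<in>\<Union>\<K>. \<exists>E B. eventually E \<U> \<and> group_bounded B \<and> biconv_nbhd E B g \<subseteq> \<Union>\<K>"
      by (blast, meson UnionE Union_upper subset_trans)
  qed
  then show ?thesis
    unfolding biconv_topology_def by (simp add: topology_inverse')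
qed

lemma topspace_biconv_topology: "topspace (biconv_topology \<U>) = Aut"
proof
  show "topspace (biconv_topology \<U>) \<subseteq> Aut"
    using openin_biconv_topology openin_topspace by blast
  have "eventually (\<lambda>_. True) \<U> \<and> group_bounded {} \<and> biconv_nbhd (\<lambda>_. True) {} g \<subseteq> Aut" for g
    by (simp add: biconv_nbhd_def group_bounded_empty)
  then have "openin (biconv_topology \<U>) Aut"
    unfolding openin_biconv_topology by blast
  then show "Aut \<subseteq> topspace (biconv_topology \<U>)"
    by (rule openin_subset)
qed

lemma limitin_biconv_topology:
  assumes refl: "\<And>E x. eventually E \<U> \<Longrightarrow> E (x, x)"
    and trans: "\<And>E. eventually E \<U> \<Longrightarrow>
      \<exists>D. eventually D \<U> \<and> (\<forall>x y z. D (x, y) \<and> D (y, z) \<longrightarrow> E (x, z))"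
  shows "limitin (biconv_topology \<U>) f g F \<longleftrightarrow>
     g \<in> Aut \<and> (\<forall>\<^sub>F i in F. f i \<in> Aut) \<and>
     uniformly_converges_on_bounded \<U> f g F \<and>
     uniformly_converges_on_bounded \<U> (\<lambda>i. inv (f i)) (inv g) F"
    (is "?L \<longleftrightarrow> ?R")
proof
  assume ?L
  have gA: "g \<in> Aut"
    using \<open>?L\<close> by (simp add: limitin_def topspace_biconv_topology)
  have fA: "\<forall>\<^sub>F i in F. f i \<in> Aut"
    using \<open>?L\<close> gA openin_topspace[of "biconv_topology \<U>"]
    unfolding limitin_def topspace_biconv_topology by blast
  have ev: "\<forall>\<^sub>F i in F. f i \<in> biconv_nbhd E B g"
    if E: "eventually E \<U>" and B: "group_bounded B" for E B
  proof -
    define W where "W = {h \<in> Aut. \<exists>D. eventually D \<U> \<and> biconv_nbhd D B h \<subseteq> biconv_nbhd E B g}"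
    have "openin (biconv_topology \<U>) W"
      unfolding openin_biconv_topology
    proof (intro conjI ballI)
      show "W \<subseteq> Aut" by (auto simp: W_def)
      fix h assume "h \<in> W"
      then obtain D where D: "eventually D \<U>" "biconv_nbhd D B h \<subseteq> biconv_nbhd E B g"
        by (auto simp: W_def)
      obtain D' where D': "eventually D' \<U>" "\<And>x y z. D' (x, y) \<Longrightarrow> D' (y, z) \<Longrightarrow> D (x, z)"
        using trans[OF D(1)] by blast
      have "biconv_nbhd D' B k \<subseteq> biconv_nbhd D B h" if "k \<in> biconv_nbhd D' B h" for k
        using that D'(2) unfolding biconv_nbhd_def by blast
      then have "biconv_nbhd D' B h \<subseteq> W"
        using D' D(2) unfolding W_def biconv_nbhd_def[of D' B h] by blast
      then show "\<exists>E B. eventually E \<U> \<and> group_bounded B \<and> biconv_nbhd E B h \<subseteq> W"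
        using D'(1) B by blast
    qed
    moreover have "g \<in> W"
      using gA E by (auto simp: W_def)
    ultimately have "\<forall>\<^sub>F i in F. f i \<in> W"
      using \<open>?L\<close> by (simp add: limitin_def)
    moreover have "W \<subseteq> biconv_nbhd E B g"
      using refl unfolding W_def biconv_nbhd_def by blast
    ultimately show ?thesis
      by (auto elim: eventually_mono)
  qed
  show ?R
    unfolding uniformly_converges_on_bounded_def
  proof (safe intro!: gA fA)
    fix B :: "'a set" and E assume "group_bounded B" "eventually E \<U>"
    then have *: "\<forall>\<^sub>F i in F. f i \<in> biconv_nbhd E B g"
      using ev by blast
    show "\<forall>\<^sub>F i in F. \<forall>x\<in>B. E (f i x, g x)"
      using * by eventually_elim (simp add: biconv_nbhd_def)
    show "\<forall>\<^sub>F i in F. \<forall>x\<in>B. E (inv (f i) x, inv g x)"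
      using * by eventually_elim (simp add: biconv_nbhd_def)
  qed
next
  assume R: ?R
  show ?L
    unfolding limitin_def topspace_biconv_topology
  proof (intro conjI allI impI)
    show "g \<in> Aut" using R by simp
    fix W assume "openin (biconv_topology \<U>) W \<and> g \<in> W"
    then obtain E B where *: "eventually E \<U>" "group_bounded B" "biconv_nbhd E B g \<subseteq> W"
      unfolding openin_biconv_topology by blast
    have "\<forall>\<^sub>F i in F. f i \<in> Aut" "\<forall>\<^sub>F i in F. \<forall>x\<in>B. E (f i x, g x)"
      "\<forall>\<^sub>F i in F. \<forall>x\<in>B. E (inv (f i) x, inv g x)"
      using R *(1,2) unfolding uniformly_converges_on_bounded_def by blast+
    then show "\<forall>\<^sub>F i in F. f i \<in> W"
      by eventually_elim (use *(3) in \<open>auto simp: biconv_nbhd_def\<close>)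
  qed
qed

lemma eventually_upper_uniformity:
  "eventually E upper_uniformity \<longleftrightarrow>
     (\<exists>V. 0 \<in> interior V \<and> (\<forall>x y. - x + y \<in> V \<and> x + - y \<in> V \<longrightarrow> E (x, y)))"
  unfolding upper_uniformity_def
proof (subst eventually_INF_base)
  show "{V :: 'a set. 0 \<in> interior V} \<noteq> {}"
    by (auto intro!: exI[of _ UNIV])
next
  fix U V :: "'a set" assume "U \<in> {V. 0 \<in> interior V}" "V \<in> {V. 0 \<in> interior V}"
  then show "\<exists>W\<in>{V. 0 \<in> interior V}. principal {(x, y). - x + y \<in> W \<and> x + - y \<in> W}
      \<le> inf (principal {(x, y). - x + y \<in> U \<and> x + - y \<in> U})
             (principal {(x, y). - x + y \<in> V \<and> x + - y \<in> V})"
    by (intro bexI[of _ "U \<inter> V"]) auto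
qed (auto simp: eventually_principal)

lemma eventually_lower_uniformity:
  "eventually E lower_uniformity \<longleftrightarrow>
     (\<exists>V. 0 \<in> interior V \<and> (\<forall>x y. x \<in> V + {y} + V \<longrightarrow> E (x, y)))"
  unfolding lower_uniformity_def
proof (subst eventually_INF_base)
  show "{V :: 'a set. 0 \<in> interior V} \<noteq> {}"
    by (auto intro!: exI[of _ UNIV])
next
  fix U V :: "'a set" assume "U \<in> {V. 0 \<in> interior V}" "V \<in> {V. 0 \<in> interior V}"
  then show "\<exists>W\<in>{V. 0 \<in> interior V}. principal {(x, y). x \<in> W + {y} + W}
      \<le> inf (principal {(x, y). x \<in> U + {y} + U}) (principal {(x, y). x \<in> V + {y} + V})"
    by (intro bexI[of _ "U \<inter> V"]) (auto simp: set_plus_def)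
qed (auto simp: eventually_principal)

lemma identity_nbhd_half:
  fixes U :: "'a::topological_group_add set"
  assumes "0 \<in> interior U"
  obtains V where "0 \<in> interior V" "\<And>v w. v \<in> V \<Longrightarrow> w \<in> V \<Longrightarrow> v + w \<in> U"
proof -
  have "filterlim (\<lambda>p. fst p + snd p) (nhds (0 + 0)) (nhds (0::'a) \<times>\<^sub>F nhds 0)"
    by (rule tendsto_add_Pair)
  moreover have "eventually (\<lambda>u. u \<in> interior U) (nhds (0 + 0 :: 'a))"
    using assms by (auto simp: eventually_nhds)
  ultimately have "eventually (\<lambda>p. fst p + snd p \<in> interior U) (nhds (0::'a) \<times>\<^sub>F nhds 0)"
    unfolding filterlim_iff by blast
  then obtain P Q where PQ: "eventually P (nhds (0::'a))" "eventually Q (nhds (0::'a))"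
    "\<And>x y. P x \<Longrightarrow> Q y \<Longrightarrow> x + y \<in> interior U"
    unfolding eventually_prod_filter by auto
  then have "eventually (\<lambda>x. P x \<and> Q x) (nhds 0)"
    by (simp add: eventually_conj)
  then obtain S where S: "open S" "0 \<in> S" "\<And>x. x \<in> S \<Longrightarrow> P x \<and> Q x"
    unfolding eventually_nhds by blast
  show ?thesis
  proof (rule that[of S])
    show "0 \<in> interior S" using S by (simp add: interior_open)
    show "v + w \<in> U" if "v \<in> S" "w \<in> S" for v w
      using that S(3) PQ(3) interior_subset by blast
  qed
qed

lemma limitin_upper_topology:
  "limitin upper_topology f g F \<longleftrightarrow>
     g \<in> Aut \<and> (\<forall>\<^sub>F i in F. f i \<in> Aut) \<and>
     uniformly_converges_on_bounded upper_uniformity f g F \<and>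
     uniformly_converges_on_bounded upper_uniformity (\<lambda>i. inv (f i)) (inv g) F"
  unfolding upper_topology_def
proof (rule limitin_biconv_topology)
  fix E :: "'a \<times> 'a \<Rightarrow> bool" assume E: "eventually E upper_uniformity"
  then obtain V where V: "0 \<in> interior V" "\<And>x y. - x + y \<in> V \<Longrightarrow> x + - y \<in> V \<Longrightarrow> E (x, y)"
    unfolding eventually_upper_uniformity by blast
  show "E (x, x)" for x
    using V interior_subset by fastforce
  obtain W where W: "0 \<in> interior W" "\<And>v w. v \<in> W \<Longrightarrow> w \<in> W \<Longrightarrow> v + w \<in> V"
    using identity_nbhd_half[OF V(1)] by metis
  have "E (x, z)" if *: "- x + y \<in> W" "x + - y \<in> W" "- y + z \<in> W" "y + - z \<in> W" for x y z
    using V(2)[of x z] W(2)[OF *(1,3)] W(2)[OF *(2,4)]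
    by (simp add: add.assoc del: add_uminus_conv_diff)
  then show "\<exists>D. eventually D upper_uniformity \<and> (\<forall>x y z. D (x, y) \<and> D (y, z) \<longrightarrow> E (x, z))"
    using W(1) unfolding eventually_upper_uniformity
    by (intro exI[of _ "\<lambda>(x, y). - x + y \<in> W \<and> x + - y \<in> W"]) blast
qed

lemma limitin_lower_topology:
  "limitin lower_topology f g F \<longleftrightarrow>
     g \<in> Aut \<and> (\<forall>\<^sub>F i in F. f i \<in> Aut) \<and>
     uniformly_converges_on_bounded lower_uniformity f g F \<and>
     uniformly_converges_on_bounded lower_uniformity (\<lambda>i. inv (f i)) (inv g) F"
  unfolding lower_topology_def
proof (rule limitin_biconv_topology)
  fix E :: "'a \<times> 'a \<Rightarrow> bool" assume E: "eventually E lower_uniformity"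
  then obtain V where V: "0 \<in> interior V" "\<And>x y. x \<in> V + {y} + V \<Longrightarrow> E (x, y)"
    unfolding eventually_lower_uniformity by blast
  have "0 \<in> V" using V(1) interior_subset by blast
  then have "x \<in> V + {x} + V" for x
    unfolding set_plus_def by force
  then show "E (x, x)" for x
    using V(2) by blast
  obtain W where W: "0 \<in> interior W" "\<And>v w. v \<in> W \<Longrightarrow> w \<in> W \<Longrightarrow> v + w \<in> V"
    using identity_nbhd_half[OF V(1)] by metis
  have "E (x, z)" if xy: "x \<in> W + {y} + W" and yz: "y \<in> W + {z} + W" for x y z
  proof -
    obtain a b c d where "a \<in> W" "b \<in> W" "c \<in> W" "d \<in> W" "x = a + y + b" "y = c + z + d"
      using xy yz unfolding set_plus_def by auto
    then have "x = (a + c) + z + (d + b)" "a + c \<in> V" "d + b \<in> V"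
      using W(2) by (simp_all add: add.assoc)
    then have "x \<in> V + {z} + V"
      unfolding set_plus_def by blast
    then show ?thesis by (rule V(2))
  qed
  then show "\<exists>D. eventually D lower_uniformity \<and> (\<forall>x y z. D (x, y) \<and> D (y, z) \<longrightarrow> E (x, z))"
    using W(1) unfolding eventually_lower_uniformity
    by (intro exI[of _ "\<lambda>(x, y). x \<in> W + {y} + W"]) blast
qed

end

theory Submission
  imports Defs
begin

text \<open>
  The upper uniform structure refines the lower one on every topological group, since
  \<open>x = (x - y) + y + 0\<close>. The converse fails in general, because the Roelcke entourages allow
  an error on both sides of \<open>y\<close>: for \<open>x = v + y + w\<close>, the difference
  \<open>x - y = v + (y + w - y)\<close> contains a conjugate of the small element \<open>w\<close> by \<open>y\<close>. The coarse
  SIN condition says precisely that such conjugates stay small as long as \<open>y\<close> ranges over a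
  bounded set, so the two uniform structures have the same entourages as seen from the points
  of a bounded set (lemma \<open>upper_entourage_from_lower_on_bounded\<close>).

  In a basic neighborhood of an automorphism \<open>g\<close> given by a bounded set \<open>B\<close>, the second
  components of the pairs to be compared are the points of \<open>g ` B\<close> and \<open>inv g ` B\<close>. These sets
  are again bounded because boundedness is defined from the topological group structure alone,
  which \<open>g\<close> and \<open>inv g\<close> preserve. Hence the basic neighborhoods of \<open>g\<close> for the two uniform
  structures refine each other (lemma \<open>openin_biconv_topology_transfer\<close>).
\<close>

lemma Aut_inv:
  assumes "g \<in> Aut"
  shows "inv g \<in> Aut"
proof -
  have bij: "bij g" and add: "\<And>x y. g (x + y) = g x + g y"
    and cont: "continuous_on UNIV g" "continuous_on UNIV (inv g)"
    using assms by (auto simp: Aut_def)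
  have "inv g (x + y) = inv g x + inv g y" for x y
    by (rule inv_f_eq[OF bij_is_inj[OF bij]])
      (simp add: add surj_f_inv_f[OF bij_is_surj[OF bij]])
  then show ?thesis
    using bij cont by (auto simp: Aut_def bij_imp_bij_inv inv_inv_eq)
qed

text \<open>Every sequence testing the boundedness of the image is pulled back along \<open>f\<close> to one
  testing the boundedness of \<open>B\<close>. The additivity is needed up to the order of the summands
  only, so that negation, an anti-automorphism, is covered as well.\<close>

lemma group_bounded_image:
  fixes f :: "'a::topological_group_add \<Rightarrow> 'b::topological_group_add"
  assumes cont: "continuous_on UNIV f"
    and add: "\<And>x y. f (x + y) = f x + f y \<or> f (x + y) = f y + f x"
    and B: "group_bounded B"
  shows "group_bounded (f ` B)"
  unfolding group_bounded_def
proof (intro allI impI)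
  fix V :: "nat \<Rightarrow> 'b set"
  assume V: "(\<forall>n. open (V n)) \<and> (\<forall>n. V n \<subseteq> V (Suc n)) \<and> (\<Union>n. V n) = UNIV \<and>
        (\<forall>n. V n + V n \<subseteq> V (Suc n))"
  have V_add: "a + b \<in> V (Suc n)" if "a \<in> V n" "b \<in> V n" for a b n
    using V that set_plus_intro by blast
  have "open (f -` V n)" for n
    using V cont by (simp add: open_vimage)
  moreover have "f -` V n + f -` V n \<subseteq> f -` V (Suc n)" for n
  proof
    fix z assume "z \<in> f -` V n + f -` V n"
    then obtain x y where "z = x + y" "f x \<in> V n" "f y \<in> V n"
      by (auto elim: set_plus_elim)
    then show "z \<in> f -` V (Suc n)"
      using add[of x y] V_add by auto
  qed
  moreover have "(\<Union>n. f -` V n) = UNIV"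
    using V by (simp flip: vimage_UN)
  moreover have "f -` V n \<subseteq> f -` V (Suc n)" for n
    using V by (simp add: vimage_mono)
  ultimately obtain k where "B \<subseteq> f -` V k"
    using B[unfolded group_bounded_def, rule_format, of "\<lambda>n. f -` V n"] by blast
  then show "\<exists>k. f ` B \<subseteq> V k"
    by blast
qed

lemma group_bounded_Aut_image:
  assumes "g \<in> Aut" "group_bounded B"
  shows "group_bounded (g ` B)"
  using assms by (intro group_bounded_image) (auto simp: Aut_def)

lemma group_bounded_uminus_image:
  fixes B :: "'a::topological_group_add set"
  assumes "group_bounded B"
  shows "group_bounded (uminus ` B)"
proof (rule group_bounded_image[OF _ _ assms])
  show "continuous_on UNIV (uminus :: 'a \<Rightarrow> 'a)"
    by (intro continuous_intros)
qed (simp add: minus_add)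

lemma identity_nbhd_symmetric:
  fixes U :: "'a::topological_group_add set"
  assumes "0 \<in> interior U"
  shows "0 \<in> interior (U \<inter> uminus -` U)"
proof -
  have "continuous_on UNIV (uminus :: 'a \<Rightarrow> 'a)"
    by (intro continuous_intros)
  then have "open (uminus -` interior U)"
    by (simp add: open_vimage)
  then have "uminus -` interior U \<subseteq> interior (uminus -` U)"
    by (simp add: interior_maximal interior_subset vimage_mono)
  then show ?thesis
    using assms by auto
qed

lemma eventually_lower_imp_upper:
  assumes "eventually E lower_uniformity"
  shows "eventually E upper_uniformity"
proof -
  obtain V where V: "0 \<in> interior V" "\<And>x y. x \<in> V + {y} + V \<Longrightarrow> E (x, y)"
    using assms unfolding eventually_lower_uniformity by blast
  have "x \<in> V + {y} + V" if "x + - y \<in> V" for x y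
  proof -
    have "0 \<in> V"
      using V(1) interior_subset by blast
    then have "(x + - y) + y + 0 \<in> V + {y} + V"
      using that by (intro set_plus_intro) auto
    then show ?thesis
      by simp
  qed
  then show ?thesis
    using V unfolding eventually_upper_uniformity by blast
qed

text \<open>This is where the coarse SIN condition enters. For \<open>x = v + y + w\<close> it is used twice: the
  difference \<open>x - y = v + (y + w - y)\<close> calls for conjugation by \<open>y\<close>, and
  \<open>- x + y = - w + (- y - v + y)\<close> for conjugation by \<open>- y\<close>. Hence it is applied to \<open>C\<close>
  together with the set of its negatives, and with a symmetric neighborhood.\<close>

lemma upper_entourage_from_lower_on_bounded:
  fixes C :: "'a::topological_group_add set"
  assumes SIN: "coarsely_SIN TYPE('a)" and C: "group_bounded C"
    and E: "eventually E upper_uniformity"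
  obtains D where "eventually D lower_uniformity" "\<And>x y. y \<in> C \<Longrightarrow> D (x, y) \<Longrightarrow> E (x, y)"
proof -
  obtain U where U: "0 \<in> interior U" "\<And>x y. - x + y \<in> U \<Longrightarrow> x + - y \<in> U \<Longrightarrow> E (x, y)"
    using E unfolding eventually_upper_uniformity by blast
  obtain W where W: "0 \<in> interior W" "\<And>v w. v \<in> W \<Longrightarrow> w \<in> W \<Longrightarrow> v + w \<in> U"
    using identity_nbhd_half[OF U(1)] by metis
  have "group_bounded (C \<union> uminus ` C)"
    using C by (intro group_bounded_Un group_bounded_uminus_image)
  then obtain V where V: "0 \<in> interior V" "\<forall>x \<in> C \<union> uminus ` C. (\<lambda>v. x + v - x) ` V \<subseteq> W"
    using SIN W(1) unfolding coarsely_SIN_def by blast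
  have conj: "y + v + - y \<in> W" "- y + v + y \<in> W" if "y \<in> C" "v \<in> V" for y v
  proof -
    have "y + v - y \<in> W" "- y + v - (- y) \<in> W"
      using V(2) that by blast+
    then show "y + v + - y \<in> W" "- y + v + y \<in> W"
      by simp_all
  qed
  define S where "S = (V \<inter> W) \<inter> uminus -` (V \<inter> W)"
  have "0 \<in> interior S"
    unfolding S_def using V(1) W(1) by (intro identity_nbhd_symmetric) simp
  then have "eventually (\<lambda>(x, y). x \<in> S + {y} + S) lower_uniformity"
    unfolding eventually_lower_uniformity by blast
  moreover have "E (x, y)" if y: "y \<in> C" and x: "x \<in> S + {y} + S" for x y
  proof -
    obtain v w where vw: "v \<in> S" "w \<in> S" "x = v + y + w"
      using x by (auto elim!: set_plus_elim)
    have "v + (y + w + - y) \<in> U"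
      using vw y by (intro W(2) conj) (auto simp: S_def)
    moreover have "- w + (- y + - v + y) \<in> U"
      using vw y by (intro W(2) conj) (auto simp: S_def)
    moreover have "x + - y = v + (y + w + - y)" "- x + y = - w + (- y + - v + y)"
      by (simp_all add: vw(3) minus_add add.assoc del: add_uminus_conv_diff)
    ultimately show ?thesis
      by (intro U(2)) simp_all
  qed
  ultimately show ?thesis
    by (intro that[of "\<lambda>(x, y). x \<in> S + {y} + S"]) auto
qed

text \<open>For the topology of biconvergence, entourages matter only through the pairs whose second
  component lies in a bounded set: around \<open>g\<close>, these second components lie in
  \<open>g ` B \<union> inv g ` B\<close>.\<close>

lemma openin_biconv_topology_transfer:
  fixes \<U> \<V> :: "('a::topological_group_add \<times> 'a) filter"
  assumes refine: "\<And>E C. eventually E \<U> \<Longrightarrow> group_bounded C \<Longrightarrow>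
      \<exists>D. eventually D \<V> \<and> (\<forall>x y. y \<in> C \<and> D (x, y) \<longrightarrow> E (x, y))"
    and W: "openin (biconv_topology \<U>) W"
  shows "openin (biconv_topology \<V>) W"
  unfolding openin_biconv_topology
proof (intro conjI ballI)
  show "W \<subseteq> Aut"
    using W by (simp add: openin_biconv_topology)
  fix g assume "g \<in> W"
  then obtain E B where EB: "eventually E \<U>" "group_bounded B" "biconv_nbhd E B g \<subseteq> W"
    using W unfolding openin_biconv_topology by blast
  have "g \<in> Aut"
    using \<open>g \<in> W\<close> \<open>W \<subseteq> Aut\<close> by blast
  then have bounded: "group_bounded (g ` B \<union> inv g ` B)"
    using EB(2) by (intro group_bounded_Un group_bounded_Aut_image Aut_inv)
  obtain D where D: "eventually D \<V>"
      "\<forall>x y. y \<in> g ` B \<union> inv g ` B \<and> D (x, y) \<longrightarrow> E (x, y)"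
    using refine[OF EB(1) bounded] by (elim exE conjE)
  have "biconv_nbhd D B g \<subseteq> biconv_nbhd E B g"
    using D(2) unfolding biconv_nbhd_def by blast
  then show "\<exists>E B. eventually E \<V> \<and> group_bounded B \<and> biconv_nbhd E B g \<subseteq> W"
    using D(1) EB(2,3) by blast
qed

theorem proposition3p6:
  assumes "locally_bounded TYPE('a::topological_group_add)"
    and "coarsely_SIN TYPE('a)"
  shows "(lower_topology :: ('a \<Rightarrow> 'a) topology) = upper_topology"
  unfolding topology_eq lower_topology_def upper_topology_def
proof (intro allI iffI)
  fix W :: "('a \<Rightarrow> 'a) set"
  show "openin (biconv_topology upper_uniformity) W"
    if "openin (biconv_topology lower_uniformity) W"
    using _ that by (rule openin_biconv_topology_transfer) (blast intro: eventually_lower_imp_upper)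
  show "openin (biconv_topology lower_uniformity) W"
    if "openin (biconv_topology upper_uniformity) W"
    using _ that
  proof (rule openin_biconv_topology_transfer)
    fix E :: "'a \<times> 'a \<Rightarrow> bool" and C :: "'a set"
    assume "eventually E upper_uniformity" "group_bounded C"
    then show "\<exists>D. eventually D lower_uniformity \<and> (\<forall>x y. y \<in> C \<and> D (x, y) \<longrightarrow> E (x, y))"
      using upper_entourage_from_lower_on_bounded[OF assms(2)] by metis
  qed
qed

end
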